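(* Let $G_1$ be a simple connected graph with $m_1\ge1$ edges, let $v\in V(G_1)$, let $k\ge1$, and let $G=G_1\oplus_vS_{k+1}$ be the graph obtained by attaching $k$ new pendant vertices to $v$ (i.e. the 1-sum of $G_1$ with the star $S_{k+1}$ whose central vertex is identified with $v$). Then $$\mathscr{K}(G)=\frac{m_1\mathscr{K}(G_1)+k\,\mu(G_1,v)+k\left(m_1+k-\frac12\right)}{m_1+k}.$$
   Context: For a connected graph $H$, effective resistance $r_H(i,j)=(e_i-e_j)^TL^\dagger(e_i-e_j)$ with $L^\dagger$ the Moore–Penrose pseudoinverse of the Laplacian (resistance with unit resistors on edges). For connected $H$ with $m\ge1$ edges and degrees $d_i$, Kemeny's constant $\mathscr{K}(H)=\sum_j\pi_jm_{ij}$ for the simple random walk ($\pi_j=d_j/2m$, $m_{ij}$ expected hitting time, $m_{jj}=0$), equal to $\frac1{4m}\sum_{i,j}d_id_jr_H(i,j)$. Moment: $\mu(H,v)=\sum_{i\in V(H)}d_ir_H(i,v)$. $S_{k+1}$ is the star on $k+1$ vertices. *)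

theory Defs
  imports "HOL-Probability.Probability" "Graph_Theory.Graph_Theory"
begin

text \<open>
  A finite simple graph is a \<^locale>\<open>pair_graph\<close>: a finite, loop-free digraph without parallel
  arcs whose arc relation is symmetric. Each undirected edge is thus represented by two arcs.
\<close>

definition num_edges :: "'a pair_pre_digraph \<Rightarrow> nat" where
  "num_edges G = card ((\<lambda>(u, w). {u, w}) ` parcs G)"

abbreviation deg :: "'a pair_pre_digraph \<Rightarrow> 'a \<Rightarrow> nat" where
  "deg G u \<equiv> out_degree (with_proj G) u"

definition is_star :: "'a pair_pre_digraph \<Rightarrow> 'a \<Rightarrow> bool" where
  "is_star S c \<longleftrightarrow> finite (pverts S) \<and> c \<in> pverts S \<and>
     parcs S = {c} \<times> (pverts S - {c}) \<union> (pverts S - {c}) \<times> {c}"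

text \<open>The two summands are taken as graphs that already share the identified vertex, and only it.\<close>

definition is_one_sum ::
  "'a pair_pre_digraph \<Rightarrow> 'a pair_pre_digraph \<Rightarrow> 'a \<Rightarrow> 'a pair_pre_digraph \<Rightarrow> bool" where
  "is_one_sum G G1 v G2 \<longleftrightarrow> pverts G1 \<inter> pverts G2 = {v} \<and>
     pverts G = pverts G1 \<union> pverts G2 \<and> parcs G = parcs G1 \<union> parcs G2"


section \<open>Effective resistance\<close>

text \<open>
  A square matrix with rows and columns indexed by a finite set \<open>V\<close> is a function of two
  arguments; values outside \<open>V \<times> V\<close> are irrelevant. The pseudoinverse is normalised to
  vanish there, which makes it unique as a function.
\<close>

definition mat_mul :: "'a set \<Rightarrow> ('a \<Rightarrow> 'a \<Rightarrow> real) \<Rightarrow> ('a \<Rightarrow> 'a \<Rightarrow> real) \<Rightarrow> 'a \<Rightarrow> 'a \<Rightarrow> real" where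
  "mat_mul V A B = (\<lambda>a b. \<Sum>c\<in>V. A a c * B c b)"

definition is_pseudoinverse :: "'a set \<Rightarrow> ('a \<Rightarrow> 'a \<Rightarrow> real) \<Rightarrow> ('a \<Rightarrow> 'a \<Rightarrow> real) \<Rightarrow> bool" where
  "is_pseudoinverse V A X \<longleftrightarrow>
     (\<forall>a\<in>V. \<forall>b\<in>V. mat_mul V (mat_mul V A X) A a b = A a b) \<and>
     (\<forall>a\<in>V. \<forall>b\<in>V. mat_mul V (mat_mul V X A) X a b = X a b) \<and>
     (\<forall>a\<in>V. \<forall>b\<in>V. mat_mul V A X a b = mat_mul V A X b a) \<and>
     (\<forall>a\<in>V. \<forall>b\<in>V. mat_mul V X A a b = mat_mul V X A b a)"

definition pseudoinverse :: "'a set \<Rightarrow> ('a \<Rightarrow> 'a \<Rightarrow> real) \<Rightarrow> 'a \<Rightarrow> 'a \<Rightarrow> real" where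
  "pseudoinverse V A =
     (THE X. is_pseudoinverse V A X \<and> (\<forall>a b. a \<notin> V \<or> b \<notin> V \<longrightarrow> X a b = 0))"

definition laplacian :: "'a pair_pre_digraph \<Rightarrow> 'a \<Rightarrow> 'a \<Rightarrow> real" where
  "laplacian G a b =
     (if a = b then real (deg G a) else 0) - (if (a, b) \<in> parcs G then 1 else 0)"

definition unit_vec_at :: "'a \<Rightarrow> 'a \<Rightarrow> real" where
  "unit_vec_at i a = (if a = i then 1 else 0)"

definition eff_resistance :: "'a pair_pre_digraph \<Rightarrow> 'a \<Rightarrow> 'a \<Rightarrow> real" where
  "eff_resistance G i j =
     (\<Sum>a\<in>pverts G. \<Sum>b\<in>pverts G.
        (unit_vec_at i a - unit_vec_at j a) * pseudoinverse (pverts G) (laplacian G) a b *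
        (unit_vec_at i b - unit_vec_at j b))"

definition moment :: "'a pair_pre_digraph \<Rightarrow> 'a \<Rightarrow> real" where
  "moment G v = (\<Sum>i\<in>pverts G. real (deg G i) * eff_resistance G i v)"


section \<open>Simple random walk and Kemeny's constant\<close>

definition srw_step :: "'a pair_pre_digraph \<Rightarrow> 'a \<Rightarrow> 'a pmf" where
  "srw_step G u = pmf_of_set {w. (u, w) \<in> parcs G}"

text \<open>The joint law of the first \<open>n + 1\<close> positions \<open>[X\<^sub>0, \<dots>, X\<^sub>n]\<close> of the walk started at \<open>X\<^sub>0 = i\<close>.\<close>

primrec srw_path :: "'a pair_pre_digraph \<Rightarrow> nat \<Rightarrow> 'a \<Rightarrow> 'a list pmf" where
  "srw_path G 0 i = return_pmf [i]"
| "srw_path G (Suc n) i = bind_pmf (srw_step G i) (\<lambda>w. map_pmf ((#) i) (srw_path G n w))"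

text \<open>The probability that the hitting time \<open>min {n. X\<^sub>n = j}\<close> of \<open>j\<close> equals \<open>n\<close>.\<close>

definition hit_prob :: "'a pair_pre_digraph \<Rightarrow> 'a \<Rightarrow> 'a \<Rightarrow> nat \<Rightarrow> real" where
  "hit_prob G i j n =
     measure_pmf.prob (srw_path G n i) {xs. xs ! n = j \<and> (\<forall>l<n. xs ! l \<noteq> j)}"

text \<open>
  On a finite connected graph with an edge the hitting time is almost surely finite and the
  series converges; on other graphs the value is not meaningful.
\<close>

definition exp_hit_time :: "'a pair_pre_digraph \<Rightarrow> 'a \<Rightarrow> 'a \<Rightarrow> real" where
  "exp_hit_time G i j = (\<Sum>n. real n * hit_prob G i j n)"

definition stationary :: "'a pair_pre_digraph \<Rightarrow> 'a \<Rightarrow> real" where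
  "stationary G j = real (deg G j) / (2 * real (num_edges G))"

text \<open>The sum is the same for every starting vertex \<open>i\<close>; Kemeny's constant is this common value.\<close>

definition kemeny :: "'a pair_pre_digraph \<Rightarrow> real" where
  "kemeny G =
     (THE K. \<forall>i\<in>pverts G. K = (\<Sum>j\<in>pverts G. stationary G j * exp_hit_time G i j))"

end

theory Submission
  imports Defs
begin

text \<open>
  Hitting times solve a Poisson equation: on a connected graph with \<open>m\<close> edges, \<open>h = h(\<cdot>, j)\<close>
  satisfies \<open>L h = d - 2 m e\<^sub>j\<close>, and by the maximum principle \<open>L h\<close> determines \<open>h\<close> up to a constant.
  Hence \<open>\<Sum>\<^sub>j d\<^sub>j h(i, j)\<close> is harmonic in \<open>i\<close>, so Kemeny's constant may be computed from any start.
  The difference \<open>h(\<cdot>, j) - h(\<cdot>, i)\<close> is \<open>2 m\<close> times the potential of a unit flow from \<open>i\<close> to \<open>j\<close>,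
  which gives the commute time identity \<open>2 m r(i, j) = h(i, j) + h(j, i)\<close>.

  In a 1-sum \<open>G\<^sub>1 \<oplus>\<^sub>v G\<^sub>2\<close> the Laplacian is the sum of the two Laplacians. Seen from \<open>G\<^sub>1\<close>, the
  other summand is an extra source of strength \<open>2 m\<^sub>2\<close> at \<open>v\<close>, so that a walk from \<open>v\<close> to
  \<open>j \<in> G\<^sub>1\<close> takes \<open>h\<^sub>1(v, j) + 2 m\<^sub>2 r\<^sub>1(j, v)\<close> steps on average. Summing over \<open>j\<close> expresses the
  constant of the 1-sum through the constants and moments of the summands; for a star with
  \<open>k\<close> leaves these are \<open>k - 1/2\<close> and \<open>k\<close>.
\<close>

section \<open>The graph Laplacian\<close>

definition nbrs :: "'a pair_pre_digraph \<Rightarrow> 'a \<Rightarrow> 'a set" where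
  "nbrs G u = {w. (u, w) \<in> parcs G}"

definition laplacian_op :: "'a pair_pre_digraph \<Rightarrow> ('a \<Rightarrow> real) \<Rightarrow> 'a \<Rightarrow> real" where
  "laplacian_op G f u = (\<Sum>w\<in>nbrs G u. f u - f w)"

lemma deg_eq_card_nbrs: "deg G u = card (nbrs G u)"
proof -
  have "out_arcs (with_proj G) u = Pair u ` nbrs G u"
    by (auto simp: out_arcs_def nbrs_def)
  then show ?thesis
    by (simp add: out_degree_def card_image inj_on_def)
qed

lemma laplacian_op_altdef: "laplacian_op G f u = real (deg G u) * f u - (\<Sum>w\<in>nbrs G u. f w)"
  by (simp add: laplacian_op_def sum_subtractf deg_eq_card_nbrs)

lemma laplacian_op_add:
  "laplacian_op G (\<lambda>x. f x + g x) u = laplacian_op G f u + laplacian_op G g u"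
  by (simp add: laplacian_op_def algebra_simps flip: sum.distrib)

lemma laplacian_op_diff:
  "laplacian_op G (\<lambda>x. f x - g x) u = laplacian_op G f u - laplacian_op G g u"
  by (simp add: laplacian_op_def algebra_simps flip: sum_subtractf)

lemma laplacian_op_cmult: "laplacian_op G (\<lambda>x. c * f x) u = c * laplacian_op G f u"
  by (simp add: laplacian_op_def sum_distrib_left algebra_simps)

lemma laplacian_op_const: "laplacian_op G (\<lambda>x. c) u = 0"
  by (simp add: laplacian_op_def)

lemma laplacian_op_sum:
  "laplacian_op G (\<lambda>x. \<Sum>i\<in>I. f i x) u = (\<Sum>i\<in>I. laplacian_op G (f i) u)"
  unfolding laplacian_op_def sum_subtractf[symmetric] by (rule sum.swap)

context pair_wf_digraph
begin

lemma nbrs_outside: "u \<notin> pverts G \<Longrightarrow> nbrs G u = {}"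
  using in_arcsD1 by (auto simp: nbrs_def)

lemma deg_outside: "u \<notin> pverts G \<Longrightarrow> deg G u = 0"
  by (simp add: deg_eq_card_nbrs nbrs_outside)

lemma laplacian_op_outside: "u \<notin> pverts G \<Longrightarrow> laplacian_op G f u = 0"
  by (simp add: laplacian_op_def nbrs_outside)

end

context pair_fin_digraph
begin

lemma nbrs_subset: "nbrs G u \<subseteq> pverts G"
  using in_arcsD2 by (auto simp: nbrs_def)

lemma finite_nbrs: "finite (nbrs G u)"
  using nbrs_subset pair_finite_verts by (rule finite_subset)

lemma sum_nbrs_eq_sum_arcs:
  fixes \<phi> :: "'a \<Rightarrow> 'a \<Rightarrow> 'b :: comm_monoid_add"
  shows "(\<Sum>u\<in>pverts G. \<Sum>w\<in>nbrs G u. \<phi> u w) = (\<Sum>(u, w)\<in>parcs G. \<phi> u w)"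
proof -
  have "Sigma (pverts G) (nbrs G) = parcs G"
    using in_arcsD1 by (auto simp: nbrs_def)
  then show ?thesis
    by (simp add: sum.Sigma pair_finite_verts finite_nbrs)
qed

lemma eq_at_nbr_if_subharmonic_maximum:
  assumes "\<And>w. w \<in> nbrs G u \<Longrightarrow> f w \<le> f u" "laplacian_op G f u \<le> 0" "w \<in> nbrs G u"
  shows "f w = f u"
proof -
  have nonneg: "0 \<le> f u - f w" if "w \<in> nbrs G u" for w
    using assms(1)[OF that] by simp
  then have "(\<Sum>w\<in>nbrs G u. f u - f w) = 0"
    using assms(2) unfolding laplacian_op_def by (intro antisym sum_nonneg)
  then have "f u - f w = 0"
    using sum_nonneg_0[of "nbrs G u" "\<lambda>w. f u - f w" w] finite_nbrs nonneg assms(3) by blast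
  then show ?thesis
    by simp
qed

end

context pair_pseudo_graph
begin

lemma sum_nbrs_swap:
  fixes \<phi> :: "'a \<Rightarrow> 'a \<Rightarrow> 'b :: comm_monoid_add"
  shows "(\<Sum>u\<in>pverts G. \<Sum>w\<in>nbrs G u. \<phi> u w) = (\<Sum>u\<in>pverts G. \<Sum>w\<in>nbrs G u. \<phi> w u)"
  unfolding sum_nbrs_eq_sum_arcs
  by (rule sum.reindex_bij_witness[of _ prod.swap prod.swap]) (auto intro: arcs_symmetric)

lemma laplacian_op_self_adjoint:
  "(\<Sum>u\<in>pverts G. g u * laplacian_op G f u) = (\<Sum>u\<in>pverts G. f u * laplacian_op G g u)"
proof -
  have "(\<Sum>u\<in>pverts G. g u * laplacian_op G f u)
      = (\<Sum>u\<in>pverts G. \<Sum>w\<in>nbrs G u. f u * g u) - (\<Sum>u\<in>pverts G. \<Sum>w\<in>nbrs G u. g u * f w)" for f g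
    by (simp add: laplacian_op_def sum_distrib_left right_diff_distrib sum_subtractf mult_ac)
  moreover have "(\<Sum>u\<in>pverts G. \<Sum>w\<in>nbrs G u. g u * f w) = (\<Sum>u\<in>pverts G. \<Sum>w\<in>nbrs G u. f u * g w)"
    by (subst sum_nbrs_swap) (simp add: mult.commute)
  ultimately show ?thesis
    by (simp add: mult.commute)
qed

lemma sum_laplacian_op: "(\<Sum>u\<in>pverts G. laplacian_op G f u) = 0"
  using laplacian_op_self_adjoint[of "\<lambda>_. 1" f] by (simp add: laplacian_op_const)

end

context pair_graph
begin

lemma card_arcs_eq_num_edges: "card (parcs G) = 2 * num_edges G"
proof -
  let ?edge = "\<lambda>(u, w). {u, w} :: 'a set"
  have fibre: "card {a \<in> parcs G. ?edge a = e} = 2" if e: "e \<in> ?edge ` parcs G" for e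
  proof -
    obtain u w where uw: "(u, w) \<in> parcs G" "e = {u, w}"
      using e by auto
    then have "{a \<in> parcs G. ?edge a = e} = {(u, w), (w, u)}"
      using arcs_symmetric by (auto simp: doubleton_eq_iff)
    then show ?thesis
      using no_loops'[OF uw(1)] by simp
  qed
  have "card (parcs G) = (\<Sum>e\<in>?edge ` parcs G. card {a \<in> parcs G. ?edge a = e})"
    using sum.image_gen[OF pair_finite_arcs, of "\<lambda>_. 1::nat" ?edge] by simp
  then show ?thesis
    using fibre by (simp add: num_edges_def)
qed

lemma sum_deg_eq_num_edges: "(\<Sum>u\<in>pverts G. real (deg G u)) = 2 * real (num_edges G)"
proof -
  have "(\<Sum>u\<in>pverts G. real (deg G u)) = real (card (parcs G))"
    using sum_nbrs_eq_sum_arcs[of "\<lambda>_ _. 1 :: real"] by (simp add: deg_eq_card_nbrs)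
  then show ?thesis
    by (simp add: card_arcs_eq_num_edges)
qed

lemma laplacian_op_eq_deg_off_vertex:
  assumes off: "\<And>u. u \<in> pverts G - {v} \<Longrightarrow> laplacian_op G f u = real (deg G u)"
    and "v \<in> pverts G" "u \<in> pverts G"
  shows "laplacian_op G f u = real (deg G u) - (if u = v then 2 * real (num_edges G) else 0)"
proof -
  have "laplacian_op G f v + (\<Sum>u\<in>pverts G - {v}. laplacian_op G f u) = 0"
    using sum_laplacian_op sum.remove[OF pair_finite_verts assms(2), of "laplacian_op G f"] by simp
  moreover have "real (deg G v) + (\<Sum>u\<in>pverts G - {v}. laplacian_op G f u) = 2 * real (num_edges G)"
    using sum_deg_eq_num_edges off
      sum.remove[OF pair_finite_verts assms(2), of "\<lambda>u. real (deg G u)"] by simp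
  ultimately show ?thesis
    using off assms(3) by (cases "u = v") auto
qed

end

lemma (in pair_sym_digraph) connected_if_reachable_from:
  assumes "v \<in> pverts G" and "\<And>u. u \<in> pverts G \<Longrightarrow> v \<rightarrow>\<^sup>*\<^bsub>G\<^esub> u"
  shows "Digraph_Component.connected (with_proj G)"
proof -
  have "u \<rightarrow>\<^sup>*\<^bsub>G\<^esub> w" if "u \<in> pverts G" "w \<in> pverts G" for u w
    using assms(2) that symmetric_reachable' reachable_trans by blast
  then show ?thesis
    using assms(1)
    by (auto simp: Digraph_Component.connected_def strongly_connected_def
        reachable_mk_symmetric_eq[OF pair_sym_arcs])
qed

locale connected_pair_graph = pair_graph G for G :: "'a pair_pre_digraph" +
  assumes connected: "Digraph_Component.connected (with_proj G)"
begin

lemma all_reachable: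
  assumes "i \<in> pverts G" "j \<in> pverts G"
  shows "i \<rightarrow>\<^sup>*\<^bsub>G\<^esub> j"
  using symmetric_connected_imp_strongly_connected[OF pair_sym_arcs connected] assms
  by (auto simp: strongly_connected_def)

lemma maximum_principle:
  assumes subharmonic: "\<And>u. u \<in> pverts G - {j} \<Longrightarrow> laplacian_op G f u \<le> 0"
    and "i \<in> pverts G" "j \<in> pverts G"
  shows "f i \<le> f j"
proof -
  have "Max (f ` pverts G) \<in> f ` pverts G"
    using pair_finite_verts assms(2) by (intro Max_in) auto
  then obtain x where x: "x \<in> pverts G" "f x = Max (f ` pverts G)"
    by auto
  then have maximal: "f u \<le> f x" if "u \<in> pverts G" for u
    using that pair_finite_verts by simp
  have "f w = f x \<or> f j = f x" if "x \<rightarrow>\<^sup>*\<^bsub>G\<^esub> w" for w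
    using that
  proof (induction rule: reachable_induct)
    case (step y z)
    show ?case
    proof (cases "f j = f x")
      case False
      then have y: "y \<in> pverts G - {j}" "f y = f x" and z: "z \<in> nbrs G y"
        using step in_arcsD1 by (auto simp: nbrs_def)
      have "f w \<le> f y" if "w \<in> nbrs G y" for w
        using maximal that nbrs_subset y(2) by auto
      then have "f z = f y"
        using subharmonic[OF y(1)] z by (rule eq_at_nbr_if_subharmonic_maximum)
      then show ?thesis
        using y(2) by simp
    qed simp
  qed simp
  then have "f j = f x"
    using all_reachable x(1) assms(3) by blast
  then show ?thesis
    using maximal[OF assms(2)] by simp
qed

lemma diff_eq_if_laplacian_op_eq:
  assumes "\<And>u. u \<in> pverts G - {j} \<Longrightarrow> laplacian_op G f u = laplacian_op G g u"
    and "i \<in> pverts G" "j \<in> pverts G"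
  shows "f i - f j = g i - g j"
proof (rule antisym)
  show "f i - f j \<le> g i - g j"
    using maximum_principle[of j "\<lambda>x. f x - g x" i] assms by (simp add: laplacian_op_diff)
  show "g i - g j \<le> f i - f j"
    using maximum_principle[of j "\<lambda>x. g x - f x" i] assms by (simp add: laplacian_op_diff)
qed

lemma harmonic_imp_constant:
  assumes "\<And>u. u \<in> pverts G \<Longrightarrow> laplacian_op G f u = 0" and "i \<in> pverts G" "j \<in> pverts G"
  shows "f i = f j"
  using diff_eq_if_laplacian_op_eq[of j f "\<lambda>_. 0" i] assms by (simp add: laplacian_op_const)

end

locale nontrivial_connected_graph = connected_pair_graph +
  assumes arcs_nonempty: "parcs G \<noteq> {}"
begin

lemma num_edges_pos: "0 < num_edges G"
  using arcs_nonempty pair_finite_arcs by (simp add: num_edges_def card_gt_0_iff)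

lemma nbrs_nonempty:
  assumes "u \<in> pverts G"
  shows "nbrs G u \<noteq> {}"
proof -
  obtain a b where ab: "(a, b) \<in> parcs G"
    using arcs_nonempty by auto
  have "u \<rightarrow>\<^sup>*\<^bsub>G\<^esub> a"
    using assms ab in_arcsD1 by (intro all_reachable) auto
  then show ?thesis
    by (cases rule: converse_reachable_cases) (use ab in \<open>auto simp: nbrs_def\<close>)
qed

lemma deg_pos: "u \<in> pverts G \<Longrightarrow> 0 < deg G u"
  using nbrs_nonempty finite_nbrs by (simp add: deg_eq_card_nbrs card_gt_0_iff)

end

section \<open>Hitting times\<close>

lemma measure_bind_pmf_of_set:
  assumes "finite A" "A \<noteq> {}"
  shows "measure_pmf.prob (bind_pmf (pmf_of_set A) f) X
    = (\<Sum>x\<in>A. measure_pmf.prob (f x) X) / real (card A)"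
  using assms
  by (simp add: measure_pmf_bind measure_pmf.measure_bind[where N = "count_space UNIV"]
      measure_pmf_in_subprob_algebra integral_pmf_of_set)

lemma hit_prob_nonneg: "0 \<le> hit_prob G i j n"
  by (simp add: hit_prob_def)

lemma hit_prob_0: "hit_prob G i j 0 = (if i = j then 1 else 0)"
  by (simp add: hit_prob_def)

lemma hit_prob_self: "hit_prob G j j n = (if n = 0 then 1 else 0)"
proof (cases n)
  case (Suc m)
  then show ?thesis
    unfolding hit_prob_def by (auto simp: measure_pmf_zero_iff)
qed (simp add: hit_prob_0)

lemma exp_hit_time_self: "exp_hit_time G j j = 0"
proof -
  have "(\<lambda>n. real n * hit_prob G j j n) = (\<lambda>_. 0)"
    by (auto simp: hit_prob_self)
  then show ?thesis
    by (simp add: exp_hit_time_def)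
qed

context nontrivial_connected_graph
begin

lemma hit_prob_Suc:
  assumes "i \<in> pverts G" "i \<noteq> j"
  shows "real (deg G i) * hit_prob G i j (Suc n) = (\<Sum>w\<in>nbrs G i. hit_prob G w j n)"
proof -
  have "(#) i -` {xs. xs ! Suc n = j \<and> (\<forall>l<Suc n. xs ! l \<noteq> j)}
      = {xs. xs ! n = j \<and> (\<forall>l<n. xs ! l \<noteq> j)}"
    using assms(2) by (auto simp: less_Suc_eq_0_disj)
  moreover have "srw_step G i = pmf_of_set (nbrs G i)"
    by (simp add: srw_step_def nbrs_def)
  ultimately have "hit_prob G i j (Suc n)
      = (\<Sum>w\<in>nbrs G i. hit_prob G w j n) / real (card (nbrs G i))"
    unfolding hit_prob_def srw_path.simps
    by (simp only: measure_map_pmf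
        measure_bind_pmf_of_set[OF finite_nbrs nbrs_nonempty[OF assms(1)]])
  then show ?thesis
    using deg_pos[OF assms(1)] by (simp add: deg_eq_card_nbrs)
qed

lemma sum_hit_prob_first_step:
  assumes "i \<in> pverts G" "i \<noteq> j"
  shows "real (deg G i) * (\<Sum>n<Suc N. c n * hit_prob G i j n)
    = (\<Sum>w\<in>nbrs G i. \<Sum>n<N. c (Suc n) * hit_prob G w j n)"
proof -
  have "real (deg G i) * (\<Sum>n<Suc N. c n * hit_prob G i j n)
      = (\<Sum>n<N. c (Suc n) * (real (deg G i) * hit_prob G i j (Suc n)))"
    using assms(2)
    by (simp add: sum.lessThan_Suc_shift hit_prob_0 sum_distrib_left mult.left_commute
        del: sum.lessThan_Suc)
  also have "\<dots> = (\<Sum>n<N. \<Sum>w\<in>nbrs G i. c (Suc n) * hit_prob G w j n)"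
    by (simp only: hit_prob_Suc[OF assms] sum_distrib_left)
  also have "\<dots> = (\<Sum>w\<in>nbrs G i. \<Sum>n<N. c (Suc n) * hit_prob G w j n)"
    by (rule sum.swap)
  finally show ?thesis .
qed

lemma suminf_hit_prob_first_step:
  assumes "i \<in> pverts G" "i \<noteq> j"
    and "summable (\<lambda>n. c n * hit_prob G i j n)"
    and "\<And>w. w \<in> nbrs G i \<Longrightarrow> summable (\<lambda>n. c (Suc n) * hit_prob G w j n)"
  shows "real (deg G i) * (\<Sum>n. c n * hit_prob G i j n)
    = (\<Sum>w\<in>nbrs G i. \<Sum>n. c (Suc n) * hit_prob G w j n)"
proof (rule LIMSEQ_unique)
  show "(\<lambda>N. real (deg G i) * (\<Sum>n<Suc N. c n * hit_prob G i j n))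
      \<longlonglongrightarrow> real (deg G i) * (\<Sum>n. c n * hit_prob G i j n)"
    by (intro tendsto_mult_left LIMSEQ_Suc summable_LIMSEQ assms(3))
  show "(\<lambda>N. real (deg G i) * (\<Sum>n<Suc N. c n * hit_prob G i j n))
      \<longlonglongrightarrow> (\<Sum>w\<in>nbrs G i. \<Sum>n. c (Suc n) * hit_prob G w j n)"
    unfolding sum_hit_prob_first_step[OF assms(1,2)] by (intro tendsto_sum summable_LIMSEQ assms(4))
qed

lemma sum_hit_prob_le_1: "i \<in> pverts G \<Longrightarrow> (\<Sum>n<N. hit_prob G i j n) \<le> 1"
proof (induction N arbitrary: i)
  case (Suc N)
  show ?case
  proof (cases "i = j")
    case False
    have "real (deg G i) * (\<Sum>n<Suc N. hit_prob G i j n) = (\<Sum>w\<in>nbrs G i. \<Sum>n<N. hit_prob G w j n)"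
      using sum_hit_prob_first_step[OF Suc.prems False, of "\<lambda>_. 1"] by simp
    also have "\<dots> \<le> (\<Sum>w\<in>nbrs G i. 1)"
      using Suc.IH nbrs_subset by (intro sum_mono) auto
    also have "\<dots> = real (deg G i) * 1"
      by (simp add: deg_eq_card_nbrs)
    finally show ?thesis
      using deg_pos[OF Suc.prems] by (simp only: mult_le_cancel_left_pos of_nat_0_less_iff)
  qed (simp add: hit_prob_self)
qed simp

lemma summable_hit_prob: "i \<in> pverts G \<Longrightarrow> summable (hit_prob G i j)"
  using hit_prob_nonneg sum_hit_prob_le_1 by (intro summableI_nonneg_bounded[where x = 1]) auto

lemma suminf_hit_prob:
  assumes "i \<in> pverts G" "j \<in> pverts G"
  shows "(\<Sum>n. hit_prob G i j n) = 1"
proof -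
  let ?p = "\<lambda>u. \<Sum>n. hit_prob G u j n"
  have "real (deg G u) * ?p u = (\<Sum>w\<in>nbrs G u. ?p w)" if "u \<in> pverts G - {j}" for u
    using suminf_hit_prob_first_step[of u j "\<lambda>_. 1"] that nbrs_subset summable_hit_prob by auto
  then have "?p i - ?p j = 1 - 1"
    using assms
    by (intro diff_eq_if_laplacian_op_eq[where g = "\<lambda>_. 1"])
      (auto simp: laplacian_op_altdef deg_eq_card_nbrs)
  moreover have "?p j = 1"
    using sums_single[of 0 "\<lambda>_. 1 :: real"] by (simp add: hit_prob_self sums_iff)
  ultimately show ?thesis
    by simp
qed

definition truncated_hit_time :: "'a \<Rightarrow> 'a \<Rightarrow> nat \<Rightarrow> real" where
  "truncated_hit_time i j N = (\<Sum>n<N. real n * hit_prob G i j n)"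

lemma truncated_hit_time_nonneg: "0 \<le> truncated_hit_time i j N"
  by (simp add: truncated_hit_time_def sum_nonneg hit_prob_nonneg)

lemma truncated_hit_time_self: "truncated_hit_time j j N = 0"
  by (auto simp: truncated_hit_time_def hit_prob_self intro!: sum.neutral)

lemma truncated_hit_time_le_Suc: "truncated_hit_time i j N \<le> truncated_hit_time i j (Suc N)"
  by (simp add: truncated_hit_time_def hit_prob_nonneg)

lemma truncated_hit_time_first_step:
  assumes "i \<in> pverts G" "i \<noteq> j"
  shows "real (deg G i) * truncated_hit_time i j (Suc N)
    = (\<Sum>w\<in>nbrs G i. truncated_hit_time w j N + (\<Sum>n<N. hit_prob G w j n))"
  using sum_hit_prob_first_step[OF assms, of real N]
  by (simp add: truncated_hit_time_def algebra_simps sum.distrib)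

text \<open>
  Uniform in \<open>N\<close>: the Laplacian of the truncated hitting times is at most the degree off \<open>j\<close>, and
  it sums to zero.
\<close>

lemma truncated_hit_time_nbr_le:
  assumes "j \<in> pverts G" "w \<in> nbrs G j"
  shows "truncated_hit_time w j N \<le> 2 * real (num_edges G)"
proof -
  let ?t = "\<lambda>u. truncated_hit_time u j N"
  have le_deg: "laplacian_op G ?t u \<le> real (deg G u)" if "u \<in> pverts G - {j}" for u
  proof -
    have "real (deg G u) * ?t u \<le> real (deg G u) * truncated_hit_time u j (Suc N)"
      by (intro mult_left_mono truncated_hit_time_le_Suc) simp
    also have "\<dots> = (\<Sum>w\<in>nbrs G u. ?t w + (\<Sum>n<N. hit_prob G w j n))"
      using that by (intro truncated_hit_time_first_step) auto
    also have "\<dots> \<le> (\<Sum>w\<in>nbrs G u. ?t w + 1)"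
      using nbrs_subset by (intro sum_mono add_left_mono sum_hit_prob_le_1) auto
    finally show ?thesis
      by (simp add: laplacian_op_altdef sum.distrib deg_eq_card_nbrs)
  qed
  have "?t w \<le> (\<Sum>w\<in>nbrs G j. ?t w)"
    using assms(2) finite_nbrs by (intro member_le_sum truncated_hit_time_nonneg)
  also have "\<dots> = - laplacian_op G ?t j"
    by (simp add: laplacian_op_def truncated_hit_time_self sum_negf)
  also have "\<dots> = (\<Sum>u\<in>pverts G - {j}. laplacian_op G ?t u)"
    using sum_laplacian_op[of ?t] sum.remove[OF pair_finite_verts assms(1), of "laplacian_op G ?t"]
    by simp
  also have "\<dots> \<le> (\<Sum>u\<in>pverts G - {j}. real (deg G u))"
    by (intro sum_mono le_deg)
  also have "\<dots> \<le> (\<Sum>u\<in>pverts G. real (deg G u))"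
    by (intro sum_mono2 pair_finite_verts) auto
  finally show ?thesis
    by (simp add: sum_deg_eq_num_edges)
qed

lemma truncated_hit_time_nbr_le_deg_mult:
  assumes "u \<in> pverts G" "u \<noteq> j" "w \<in> nbrs G u"
  shows "truncated_hit_time w j N \<le> real (deg G u) * truncated_hit_time u j (Suc N)"
proof -
  have "truncated_hit_time w j N \<le> truncated_hit_time w j N + (\<Sum>n<N. hit_prob G w j n)"
    by (simp add: sum_nonneg hit_prob_nonneg)
  also have "\<dots> \<le> (\<Sum>w\<in>nbrs G u. truncated_hit_time w j N + (\<Sum>n<N. hit_prob G w j n))"
    using assms(3) finite_nbrs
    by (intro member_le_sum)
      (auto intro!: add_nonneg_nonneg truncated_hit_time_nonneg sum_nonneg hit_prob_nonneg)
  finally show ?thesis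
    by (simp add: truncated_hit_time_first_step[OF assms(1,2)])
qed

lemma truncated_hit_time_bounded:
  assumes "i \<in> pverts G" "j \<in> pverts G"
  shows "\<exists>B. \<forall>N. truncated_hit_time i j N \<le> B"
proof -
  have "j \<rightarrow>\<^sup>*\<^bsub>G\<^esub> i"
    using assms by (intro all_reachable)
  then show ?thesis
  proof (induction rule: reachable_induct)
    case base
    then show ?case
      by (auto simp: truncated_hit_time_self)
  next
    case (step u w)
    then have uw: "u \<in> pverts G" "w \<in> nbrs G u"
      using in_arcsD1 by (auto simp: nbrs_def)
    obtain B where B: "truncated_hit_time u j N \<le> B" for N
      using step.IH by blast
    show ?case
    proof (cases "u = j")
      case True
      then show ?thesis
        using truncated_hit_time_nbr_le uw by blast
    next
      case False
      have "truncated_hit_time w j N \<le> real (deg G u) * B" for N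
        using truncated_hit_time_nbr_le_deg_mult[OF uw(1) False uw(2)] B[of "Suc N"]
        by (meson mult_left_mono of_nat_0_le_iff order_trans)
      then show ?thesis
        by blast
    qed
  qed
qed

lemma summable_hit_time:
  assumes "i \<in> pverts G" "j \<in> pverts G"
  shows "summable (\<lambda>n. real n * hit_prob G i j n)"
proof -
  obtain B where "truncated_hit_time i j N \<le> B" for N
    using truncated_hit_time_bounded[OF assms] by blast
  then show ?thesis
    by (intro summableI_nonneg_bounded[where x = B])
      (auto simp: truncated_hit_time_def hit_prob_nonneg)
qed

lemma exp_hit_time_first_step:
  assumes "i \<in> pverts G" "j \<in> pverts G" "i \<noteq> j"
  shows "real (deg G i) * exp_hit_time G i j = (\<Sum>w\<in>nbrs G i. exp_hit_time G w j + 1)"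
proof -
  have "(\<lambda>n. real (Suc n) * hit_prob G w j n) sums (exp_hit_time G w j + 1)" if "w \<in> pverts G" for w
    using sums_add[OF summable_sums[OF summable_hit_time] summable_sums[OF summable_hit_prob],
        of w j w j] that assms(2) suminf_hit_prob[OF that assms(2)]
    by (simp add: exp_hit_time_def algebra_simps)
  then have "real (deg G i) * (\<Sum>n. real n * hit_prob G i j n)
      = (\<Sum>w\<in>nbrs G i. exp_hit_time G w j + 1)"
    using assms nbrs_subset summable_hit_time
    by (subst suminf_hit_prob_first_step) (auto simp: sums_iff subset_eq intro!: sum.cong)
  then show ?thesis
    by (simp add: exp_hit_time_def)
qed

theorem laplacian_op_exp_hit_time:
  assumes "u \<in> pverts G" "j \<in> pverts G"
  shows "laplacian_op G (\<lambda>i. exp_hit_time G i j) u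
    = real (deg G u) - (if u = j then 2 * real (num_edges G) else 0)"
proof (rule laplacian_op_eq_deg_off_vertex[OF _ assms(2,1)])
  fix u assume "u \<in> pverts G - {j}"
  then show "laplacian_op G (\<lambda>i. exp_hit_time G i j) u = real (deg G u)"
    using exp_hit_time_first_step[of u j] assms(2)
    by (simp add: laplacian_op_altdef sum.distrib deg_eq_card_nbrs)
qed

lemma sum_stationary: "(\<Sum>j\<in>pverts G. stationary G j) = 1"
  using num_edges_pos by (simp add: stationary_def sum_deg_eq_num_edges flip: sum_divide_distrib)

lemma sum_stationary_exp_hit_time_constant:
  assumes "a \<in> pverts G" "b \<in> pverts G"
  shows "(\<Sum>j\<in>pverts G. stationary G j * exp_hit_time G a j)
    = (\<Sum>j\<in>pverts G. stationary G j * exp_hit_time G b j)"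
proof (rule harmonic_imp_constant[OF _ assms])
  fix u assume u: "u \<in> pverts G"
  have "laplacian_op G (\<lambda>i. \<Sum>j\<in>pverts G. stationary G j * exp_hit_time G i j) u
      = (\<Sum>j\<in>pverts G. stationary G j
          * (real (deg G u) - (if u = j then 2 * real (num_edges G) else 0)))"
    using u by (simp add: laplacian_op_sum laplacian_op_cmult laplacian_op_exp_hit_time)
  also have "\<dots> = (\<Sum>j\<in>pverts G. stationary G j * real (deg G u)
      - (if u = j then 2 * real (num_edges G) * stationary G j else 0))"
    by (intro sum.cong) (auto simp: algebra_simps)
  also have "\<dots> = real (deg G u) - 2 * real (num_edges G) * stationary G u"
    using u pair_finite_verts sum_stationary
    by (simp add: sum_subtractf sum.delta' flip: sum_distrib_right)
  also have "\<dots> = 0"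
    using num_edges_pos by (simp add: stationary_def)
  finally show "laplacian_op G (\<lambda>i. \<Sum>j\<in>pverts G. stationary G j * exp_hit_time G i j) u = 0" .
qed

theorem kemeny_eq:
  assumes "i \<in> pverts G"
  shows "2 * real (num_edges G) * kemeny G = (\<Sum>j\<in>pverts G. real (deg G j) * exp_hit_time G i j)"
proof -
  have "kemeny G = (\<Sum>j\<in>pverts G. stationary G j * exp_hit_time G i j)"
    unfolding kemeny_def
    using assms sum_stationary_exp_hit_time_constant by (intro the_equality) blast+
  then show ?thesis
    using num_edges_pos by (simp add: stationary_def sum_distrib_left)
qed

end

section \<open>Pseudoinverses of symmetric matrices\<close>

definition mat_eq_on :: "'a set \<Rightarrow> ('a \<Rightarrow> 'a \<Rightarrow> real) \<Rightarrow> ('a \<Rightarrow> 'a \<Rightarrow> real) \<Rightarrow> bool" where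
  "mat_eq_on V A B \<longleftrightarrow> (\<forall>a\<in>V. \<forall>b\<in>V. A a b = B a b)"

definition mat_transpose :: "('a \<Rightarrow> 'a \<Rightarrow> real) \<Rightarrow> 'a \<Rightarrow> 'a \<Rightarrow> real" where
  "mat_transpose A = (\<lambda>a b. A b a)"

lemma mat_eq_on_refl: "mat_eq_on V A A"
  by (simp add: mat_eq_on_def)

lemma mat_eq_on_sym: "mat_eq_on V A B \<Longrightarrow> mat_eq_on V B A"
  by (simp add: mat_eq_on_def)

lemma mat_eq_on_trans [trans]: "mat_eq_on V A B \<Longrightarrow> mat_eq_on V B C \<Longrightarrow> mat_eq_on V A C"
  by (simp add: mat_eq_on_def)

lemma mat_eq_on_eq_trans [trans]: "mat_eq_on V A B \<Longrightarrow> B = C \<Longrightarrow> mat_eq_on V A C"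
  by simp

lemma eq_mat_eq_on_trans [trans]: "A = B \<Longrightarrow> mat_eq_on V B C \<Longrightarrow> mat_eq_on V A C"
  by simp

lemma mat_eq_on_mul:
  "mat_eq_on V A A' \<Longrightarrow> mat_eq_on V B B' \<Longrightarrow> mat_eq_on V (mat_mul V A B) (mat_mul V A' B')"
  by (auto simp: mat_eq_on_def mat_mul_def intro!: sum.cong)

lemmas mat_eq_on_mul_left = mat_eq_on_mul[OF _ mat_eq_on_refl]
lemmas mat_eq_on_mul_right = mat_eq_on_mul[OF mat_eq_on_refl]

lemma mat_eq_on_transpose_iff:
  "mat_eq_on V (mat_transpose A) (mat_transpose B) \<longleftrightarrow> mat_eq_on V A B"
  by (auto simp: mat_eq_on_def mat_transpose_def)

lemmas mat_eq_on_transpose = mat_eq_on_transpose_iff[THEN iffD2]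

lemma mat_transpose_transpose: "mat_transpose (mat_transpose A) = A"
  by (simp add: mat_transpose_def)

lemma mat_transpose_mul:
  "mat_transpose (mat_mul V A B) = mat_mul V (mat_transpose B) (mat_transpose A)"
  by (simp add: mat_transpose_def mat_mul_def mult.commute)

lemma mat_mul_assoc: "mat_mul V (mat_mul V A B) C = mat_mul V A (mat_mul V B C)"
proof (intro ext)
  fix a b
  have "(\<Sum>c\<in>V. \<Sum>d\<in>V. A a d * B d c * C c b) = (\<Sum>d\<in>V. \<Sum>c\<in>V. A a d * B d c * C c b)"
    by (rule sum.swap)
  then show "mat_mul V (mat_mul V A B) C a b = mat_mul V A (mat_mul V B C) a b"
    by (simp add: mat_mul_def sum_distrib_left sum_distrib_right mult.assoc)
qed

lemma is_pseudoinverse_iff: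
  "is_pseudoinverse V A X \<longleftrightarrow>
    mat_eq_on V (mat_mul V (mat_mul V A X) A) A \<and>
    mat_eq_on V (mat_mul V (mat_mul V X A) X) X \<and>
    mat_eq_on V (mat_mul V A X) (mat_transpose (mat_mul V A X)) \<and>
    mat_eq_on V (mat_mul V X A) (mat_transpose (mat_mul V X A))"
  by (simp add: is_pseudoinverse_def mat_eq_on_def mat_transpose_def)

lemma is_pseudoinverse_transpose:
  assumes "is_pseudoinverse V A X"
  shows "is_pseudoinverse V (mat_transpose A) (mat_transpose X)"
  using assms unfolding is_pseudoinverse_iff
  by (simp add: mat_eq_on_transpose_iff mat_transpose_transpose mat_mul_assoc mat_eq_on_sym
      flip: mat_transpose_mul)

lemma is_pseudoinverse_cong:
  assumes "is_pseudoinverse V A X" "mat_eq_on V X Y"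
  shows "is_pseudoinverse V A Y"
proof -
  have "mat_eq_on V (mat_mul V A X) (mat_mul V A Y)" "mat_eq_on V (mat_mul V X A) (mat_mul V Y A)"
    using assms(2) by (auto intro: mat_eq_on_mul_left mat_eq_on_mul_right)
  then show ?thesis
    using assms unfolding is_pseudoinverse_iff
    by (meson mat_eq_on_mul mat_eq_on_refl mat_eq_on_sym mat_eq_on_trans mat_eq_on_transpose)
qed

lemma mat_mul_pseudoinverse_unique:
  assumes X: "is_pseudoinverse V A X" and Y: "is_pseudoinverse V A Y"
  shows "mat_eq_on V (mat_mul V A X) (mat_mul V A Y)"
proof -
  let ?AX = "mat_mul V A X" and ?AY = "mat_mul V A Y"
  note X = X[unfolded is_pseudoinverse_iff] and Y = Y[unfolded is_pseudoinverse_iff]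
  have "mat_eq_on V ?AX (mat_mul V (mat_mul V ?AY A) X)"
    using Y by (intro mat_eq_on_mul_left) (simp add: mat_eq_on_sym)
  also have "mat_mul V (mat_mul V ?AY A) X = mat_mul V ?AY ?AX"
    by (simp add: mat_mul_assoc)
  also have "mat_eq_on V \<dots> (mat_mul V (mat_transpose ?AY) (mat_transpose ?AX))"
    using X Y by (intro mat_eq_on_mul) auto
  also have "mat_mul V (mat_transpose ?AY) (mat_transpose ?AX)
      = mat_transpose (mat_mul V (mat_mul V ?AX A) Y)"
    by (simp add: mat_mul_assoc flip: mat_transpose_mul)
  also have "mat_eq_on V \<dots> (mat_transpose ?AY)"
    using X by (intro mat_eq_on_transpose mat_eq_on_mul_left) simp
  also have "mat_eq_on V \<dots> ?AY"
    using Y by (simp add: mat_eq_on_sym)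
  finally show ?thesis .
qed

lemma is_pseudoinverse_unique:
  assumes X: "is_pseudoinverse V A X" and Y: "is_pseudoinverse V A Y"
  shows "mat_eq_on V X Y"
proof -
  have AX_AY: "mat_eq_on V (mat_mul V A X) (mat_mul V A Y)"
    using assms by (rule mat_mul_pseudoinverse_unique)
  have XA_YA: "mat_eq_on V (mat_mul V X A) (mat_mul V Y A)"
    unfolding mat_eq_on_transpose_iff[of V "mat_mul V X A", symmetric] mat_transpose_mul
    using assms by (intro mat_mul_pseudoinverse_unique is_pseudoinverse_transpose)
  have "mat_eq_on V X (mat_mul V (mat_mul V X A) X)"
    using X by (simp add: is_pseudoinverse_iff mat_eq_on_sym)
  also have "mat_mul V (mat_mul V X A) X = mat_mul V X (mat_mul V A X)"
    by (rule mat_mul_assoc)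
  also have "mat_eq_on V \<dots> (mat_mul V X (mat_mul V A Y))"
    using AX_AY by (rule mat_eq_on_mul_right)
  also have "mat_mul V X (mat_mul V A Y) = mat_mul V (mat_mul V X A) Y"
    by (rule mat_mul_assoc[symmetric])
  also have "mat_eq_on V \<dots> (mat_mul V (mat_mul V Y A) Y)"
    using XA_YA by (rule mat_eq_on_mul_left)
  also have "mat_eq_on V \<dots> Y"
    using Y by (simp add: is_pseudoinverse_iff)
  finally show ?thesis .
qed

lemma is_pseudoinverse_pseudoinverse:
  assumes "is_pseudoinverse V A X"
  shows "is_pseudoinverse V A (pseudoinverse V A)"
proof -
  let ?P = "\<lambda>Y. is_pseudoinverse V A Y \<and> (\<forall>a b. a \<notin> V \<or> b \<notin> V \<longrightarrow> Y a b = 0)"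
  define Z where "Z a b = (if a \<in> V \<and> b \<in> V then X a b else 0)" for a b
  have "mat_eq_on V X Z"
    by (simp add: mat_eq_on_def Z_def)
  then have "?P Z"
    using is_pseudoinverse_cong[OF assms] by (simp add: Z_def)
  moreover have "Y = Z" if "?P Y" for Y
  proof (intro ext)
    fix a b
    show "Y a b = Z a b"
      using is_pseudoinverse_unique[of V A Y Z] that \<open>?P Z\<close>
      by (cases "a \<in> V \<and> b \<in> V") (auto simp: mat_eq_on_def Z_def)
  qed
  ultimately have "?P (pseudoinverse V A)"
    unfolding pseudoinverse_def by (rule theI)
  then show ?thesis ..
qed

lemma symmetric_is_pseudoinverseI:
  assumes A_sym: "mat_transpose A = A" and P_sym: "mat_transpose P = P"
    and AX: "mat_eq_on V (mat_mul V A X) P"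
    and PA: "mat_eq_on V (mat_mul V P A) A"
    and PX: "mat_eq_on V (mat_mul V P X) X"
  shows "is_pseudoinverse V A X"
proof -
  have XtA: "mat_eq_on V (mat_mul V (mat_transpose X) A) P"
    using mat_eq_on_transpose[OF AX] by (simp add: mat_transpose_mul A_sym P_sym)
  have "mat_eq_on V (mat_transpose X) (mat_mul V (mat_transpose X) P)"
    using mat_eq_on_transpose[OF mat_eq_on_sym[OF PX]] by (simp add: mat_transpose_mul P_sym)
  also have "mat_eq_on V \<dots> (mat_mul V (mat_transpose X) (mat_mul V A X))"
    by (rule mat_eq_on_mul_right[OF mat_eq_on_sym[OF AX]])
  also have "\<dots> = mat_mul V (mat_mul V (mat_transpose X) A) X"
    by (rule mat_mul_assoc[symmetric])
  also have "mat_eq_on V \<dots> (mat_mul V P X)"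
    using XtA by (rule mat_eq_on_mul_left)
  also note PX
  finally have "mat_eq_on V (mat_transpose X) X" .
  then have XA: "mat_eq_on V (mat_mul V X A) P"
    using XtA mat_eq_on_mul_left mat_eq_on_sym mat_eq_on_trans by blast
  have "mat_eq_on V B (mat_transpose B)" if "mat_eq_on V B P" for B
    using that mat_eq_on_transpose[OF that] P_sym by (metis mat_eq_on_sym mat_eq_on_trans)
  then show ?thesis
    unfolding is_pseudoinverse_iff
    using AX PA PX XA mat_eq_on_mul_left mat_eq_on_trans by blast
qed

definition centering_matrix :: "'a set \<Rightarrow> 'a \<Rightarrow> 'a \<Rightarrow> real" where
  "centering_matrix V a b = (if a = b then 1 else 0) - 1 / real (card V)"

lemma mat_transpose_centering_matrix: "mat_transpose (centering_matrix V) = centering_matrix V"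
  by (auto simp: mat_transpose_def centering_matrix_def fun_eq_iff)

lemma mat_mul_centering_matrix:
  assumes "finite V" "b \<in> V"
  shows "mat_mul V A (centering_matrix V) a b = A a b - (\<Sum>c\<in>V. A a c) / real (card V)"
proof -
  have "mat_mul V A (centering_matrix V) a b
      = (\<Sum>c\<in>V. (if c = b then A a c else 0) - A a c / real (card V))"
    unfolding mat_mul_def centering_matrix_def by (intro sum.cong) (auto simp: algebra_simps)
  then show ?thesis
    using assms by (simp add: sum_subtractf sum_divide_distrib)
qed

lemma mat_mul_centering_matrix_eq:
  assumes "finite V" "\<And>a. a \<in> V \<Longrightarrow> (\<Sum>c\<in>V. A a c) = 0"
  shows "mat_eq_on V (mat_mul V A (centering_matrix V)) A"
  using assms by (simp add: mat_eq_on_def mat_mul_centering_matrix)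

lemma sum_centering_matrix:
  assumes "finite V" "a \<in> V"
  shows "(\<Sum>b\<in>V. centering_matrix V a b) = 0"
  using assms by (auto simp: centering_matrix_def sum_subtractf)

section \<open>Effective resistance\<close>

lemma (in pair_fin_digraph) mat_mul_laplacian:
  assumes "a \<in> pverts G"
  shows "mat_mul (pverts G) (laplacian G) A a b = laplacian_op G (\<lambda>c. A c b) a"
proof -
  have "mat_mul (pverts G) (laplacian G) A a b
      = (\<Sum>c\<in>pverts G. (if a = c then real (deg G a) * A c b else 0)
          - (if c \<in> nbrs G a then A c b else 0))"
    unfolding mat_mul_def by (intro sum.cong) (auto simp: laplacian_def nbrs_def algebra_simps)
  also have "\<dots> = real (deg G a) * A a b - (\<Sum>c\<in>pverts G \<inter> nbrs G a. A c b)"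
    using assms pair_finite_verts by (simp add: sum_subtractf sum.delta' sum.inter_restrict)
  also have "pverts G \<inter> nbrs G a = nbrs G a"
    using nbrs_subset by auto
  finally show ?thesis
    by (simp add: laplacian_op_altdef)
qed

lemma (in pair_fin_digraph) sum_laplacian:
  assumes "a \<in> pverts G"
  shows "(\<Sum>c\<in>pverts G. laplacian G a c) = 0"
  using mat_mul_laplacian[OF assms, of "\<lambda>_ _. 1"] by (simp add: mat_mul_def laplacian_op_const)

lemma (in pair_fin_digraph) laplacian_op_pseudoinverse:
  assumes X: "is_pseudoinverse (pverts G) (laplacian G) X"
    and e: "\<And>b. b \<in> pverts G \<Longrightarrow> laplacian_op G f b = e b"
    and u: "u \<in> pverts G"
  shows "laplacian_op G (\<lambda>a. \<Sum>b\<in>pverts G. X a b * e b) u = e u"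
proof -
  let ?mul = "mat_mul (pverts G)" and ?L = "laplacian G" and ?F = "\<lambda>a _. f a"
  have "(\<lambda>a. \<Sum>b\<in>pverts G. X a b * e b) = (\<lambda>a. ?mul X (?mul ?L ?F) a u)"
    by (auto simp: mat_mul_def[of _ X] mat_mul_laplacian e)
  then have "laplacian_op G (\<lambda>a. \<Sum>b\<in>pverts G. X a b * e b) u = ?mul (?mul (?mul ?L X) ?L) ?F u u"
    using u by (simp add: mat_mul_assoc mat_mul_laplacian)
  also have "\<dots> = ?mul ?L ?F u u"
    using X mat_eq_on_mul_left u unfolding is_pseudoinverse_iff mat_eq_on_def by blast
  also have "\<dots> = e u"
    using u by (simp add: mat_mul_laplacian e)
  finally show ?thesis .
qed

lemma (in pair_sym_digraph) mat_transpose_laplacian: "mat_transpose (laplacian G) = laplacian G"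
  using arcs_symmetric by (auto simp: mat_transpose_def laplacian_def fun_eq_iff)

context nontrivial_connected_graph
begin

text \<open>
  Up to the factor \<open>- 2 m\<close> the matrix of hitting times is a right inverse of the Laplacian modulo
  a matrix with constant rows, which centering removes.
\<close>

lemma laplacian_centered_hit_time:
  defines "H \<equiv> \<lambda>a b. - exp_hit_time G a b / (2 * real (num_edges G))"
    and "D \<equiv> centering_matrix (pverts G)"
  shows "mat_eq_on (pverts G) (mat_mul (pverts G) (mat_mul (pverts G) (laplacian G) H) D) D"
proof -
  let ?V = "pverts G" and ?mul = "mat_mul (pverts G)" and ?L = "laplacian G"
  define m where "m = real (num_edges G)"
  have m: "m > 0"
    using num_edges_pos by (simp add: m_def)
  have LH: "?mul ?L H a b = (if a = b then 1 else 0) - real (deg G a) / (2 * m)"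
    if "a \<in> ?V" "b \<in> ?V" for a b
  proof -
    have "?mul ?L H a b = - (1 / (2 * m)) * laplacian_op G (\<lambda>c. exp_hit_time G c b) a"
      unfolding mat_mul_laplacian[OF that(1)] laplacian_op_cmult[symmetric]
      by (simp add: H_def m_def)
    then show ?thesis
      using that m by (simp add: laplacian_op_exp_hit_time field_simps flip: m_def)
  qed
  show ?thesis
    unfolding mat_eq_on_def D_def
  proof (intro ballI)
    fix a b assume ab: "a \<in> ?V" "b \<in> ?V"
    then have "card ?V \<noteq> 0"
      using pair_finite_verts by auto
    moreover have "(\<Sum>c\<in>?V. ?mul ?L H a c) = 1 - real (card ?V) * (real (deg G a) / (2 * m))"
      using ab pair_finite_verts by (simp add: LH sum_subtractf)
    ultimately show "?mul (?mul ?L H) (centering_matrix ?V) a b = centering_matrix ?V a b"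
      using ab pair_finite_verts
      by (simp add: mat_mul_centering_matrix LH centering_matrix_def diff_divide_distrib)
  qed
qed

lemma laplacian_has_pseudoinverse: "\<exists>X. is_pseudoinverse (pverts G) (laplacian G) X"
proof -
  let ?mul = "mat_mul (pverts G)" and ?L = "laplacian G"
  define D where "D = centering_matrix (pverts G)"
  define H where "H = (\<lambda>a b. - exp_hit_time G a b / (2 * real (num_edges G)))"
  have LD: "mat_eq_on (pverts G) (?mul ?L D) ?L" and DD: "mat_eq_on (pverts G) (?mul D D) D"
    unfolding D_def
    by (simp_all add: mat_mul_centering_matrix_eq pair_finite_verts sum_laplacian
        sum_centering_matrix)
  have D_sym: "mat_transpose D = D"
    by (simp add: D_def mat_transpose_centering_matrix)
  have "?mul ?L (?mul D (?mul H D)) = ?mul (?mul ?L D) (?mul H D)"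
    by (rule mat_mul_assoc[symmetric])
  also have "mat_eq_on (pverts G) \<dots> (?mul ?L (?mul H D))"
    using LD by (rule mat_eq_on_mul_left)
  also have "?mul ?L (?mul H D) = ?mul (?mul ?L H) D"
    by (rule mat_mul_assoc[symmetric])
  also have "mat_eq_on (pverts G) \<dots> D"
    unfolding D_def H_def by (rule laplacian_centered_hit_time)
  finally have LX: "mat_eq_on (pverts G) (?mul ?L (?mul D (?mul H D))) D" .
  have DL: "mat_eq_on (pverts G) (?mul D ?L) ?L"
    using mat_eq_on_transpose[OF LD] by (simp add: mat_transpose_mul mat_transpose_laplacian D_sym)
  have "mat_eq_on (pverts G) (?mul D (?mul D (?mul H D))) (?mul D (?mul H D))"
    unfolding mat_mul_assoc[symmetric, of _ D D] using DD by (rule mat_eq_on_mul_left)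
  then have "is_pseudoinverse (pverts G) ?L (?mul D (?mul H D))"
    by (rule symmetric_is_pseudoinverseI[OF mat_transpose_laplacian D_sym LX DL])
  then show ?thesis
    by blast
qed

lemma eff_resistance_eq_potential_diff:
  assumes "i \<in> pverts G" "j \<in> pverts G"
    and unit_flow: "\<And>u. u \<in> pverts G \<Longrightarrow> laplacian_op G f u = unit_vec_at i u - unit_vec_at j u"
  shows "eff_resistance G i j = f i - f j"
proof -
  let ?V = "pverts G" and ?X = "pseudoinverse (pverts G) (laplacian G)"
  define e where "e u = unit_vec_at i u - unit_vec_at j u" for u
  define y where "y a = (\<Sum>b\<in>?V. ?X a b * e b)" for a
  have "is_pseudoinverse ?V (laplacian G) ?X"
    using laplacian_has_pseudoinverse is_pseudoinverse_pseudoinverse by blast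
  then have lap_y: "laplacian_op G y u = e u" if "u \<in> ?V" for u
    unfolding y_def using unit_flow that by (intro laplacian_op_pseudoinverse) (auto simp: e_def)
  have "eff_resistance G i j = (\<Sum>a\<in>?V. y a * e a)"
    by (simp add: eff_resistance_def y_def e_def sum_distrib_left sum_distrib_right mult_ac)
  also have "\<dots> = (\<Sum>a\<in>?V. y a * laplacian_op G f a)"
    by (simp add: unit_flow e_def)
  also have "\<dots> = (\<Sum>a\<in>?V. f a * laplacian_op G y a)"
    by (rule laplacian_op_self_adjoint)
  also have "\<dots> = (\<Sum>a\<in>?V. (if a = i then f a else 0) - (if a = j then f a else 0))"
    by (intro sum.cong) (auto simp: lap_y e_def unit_vec_at_def)
  also have "\<dots> = f i - f j"
    using assms(1,2) pair_finite_verts by (simp add: sum_subtractf)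
  finally show ?thesis .
qed

theorem commute_time_identity:
  assumes "i \<in> pverts G" "j \<in> pverts G"
  shows "2 * real (num_edges G) * eff_resistance G i j = exp_hit_time G i j + exp_hit_time G j i"
proof -
  define c where "c = 1 / (2 * real (num_edges G))"
  have "laplacian_op G (\<lambda>u. c * (exp_hit_time G u j - exp_hit_time G u i)) u
      = unit_vec_at i u - unit_vec_at j u" if "u \<in> pverts G" for u
    unfolding laplacian_op_cmult laplacian_op_diff
    using that assms num_edges_pos by (auto simp: laplacian_op_exp_hit_time unit_vec_at_def c_def)
  then have "eff_resistance G i j
      = c * (exp_hit_time G i j - exp_hit_time G i i)
        - c * (exp_hit_time G j j - exp_hit_time G j i)"
    by (rule eff_resistance_eq_potential_diff[OF assms])
  then show ?thesis
    using num_edges_pos by (simp add: exp_hit_time_self c_def field_simps)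
qed

end

section \<open>1-sums\<close>

locale one_sum = G1: nontrivial_connected_graph G1 + G2: nontrivial_connected_graph G2
  for G1 G2 :: "'a pair_pre_digraph" +
  fixes G :: "'a pair_pre_digraph" and v :: 'a
  assumes is_one_sum: "is_one_sum G G1 v G2"
begin

lemma one_sum_commute: "one_sum G2 G1 G v"
  using is_one_sum by unfold_locales (auto simp: is_one_sum_def)

lemma verts_inter: "pverts G1 \<inter> pverts G2 = {v}"
  and verts_one_sum: "pverts G = pverts G1 \<union> pverts G2"
  and arcs_one_sum: "parcs G = parcs G1 \<union> parcs G2"
  using is_one_sum by (auto simp: is_one_sum_def)

lemma cut_vertex_in_verts: "v \<in> pverts G1" "v \<in> pverts G2"
  using verts_inter by auto

lemma pair_graph_one_sum: "pair_graph G"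
proof
  show "symmetric (with_proj G)"
    using G1.arcs_symmetric G2.arcs_symmetric
    by (auto simp: symmetric_def arcs_one_sum intro!: symI)
qed (auto simp: verts_one_sum arcs_one_sum G1.pair_finite_verts G2.pair_finite_verts
    G1.pair_finite_arcs G2.pair_finite_arcs dest: G1.in_arcsD1 G1.in_arcsD2 G2.in_arcsD1
    G2.in_arcsD2 G1.no_loops' G2.no_loops')

end

sublocale one_sum \<subseteq> nontrivial_connected_graph G
proof -
  interpret pair_graph G
    by (rule pair_graph_one_sum)
  have "subgraph (with_proj G1) (with_proj G)" "subgraph (with_proj G2) (with_proj G)"
    using G1.wf_digraph_axioms G2.wf_digraph_axioms wf_digraph_axioms
    by (auto simp: subgraph_def compatible_def verts_one_sum arcs_one_sum)
  then have "v \<rightarrow>\<^sup>*\<^bsub>G\<^esub> u" if "u \<in> pverts G" for u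
    using that verts_one_sum G1.all_reachable[OF cut_vertex_in_verts(1)]
      G2.all_reachable[OF cut_vertex_in_verts(2)] reachable_mono by blast
  then have "Digraph_Component.connected (with_proj G)"
    using cut_vertex_in_verts(1) verts_one_sum by (intro connected_if_reachable_from[of v]) auto
  moreover have "parcs G \<noteq> {}"
    using arcs_one_sum G1.arcs_nonempty by simp
  ultimately show "nontrivial_connected_graph G"
    by unfold_locales
qed

context one_sum
begin

lemma nbrs_one_sum: "nbrs G u = nbrs G1 u \<union> nbrs G2 u"
  by (auto simp: nbrs_def arcs_one_sum)

lemma nbrs_disjoint: "nbrs G1 u \<inter> nbrs G2 u = {}"
proof -
  have "w \<notin> nbrs G2 u" if "w \<in> nbrs G1 u" for w
  proof
    assume "w \<in> nbrs G2 u"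
    with that have "u \<in> pverts G1 \<inter> pverts G2" "w \<in> pverts G1 \<inter> pverts G2" "u \<noteq> w"
      using G1.in_arcsD1 G2.in_arcsD1 G1.in_arcsD2 G2.in_arcsD2 G1.no_loops'
      by (auto simp: nbrs_def)
    then show False
      by (simp add: verts_inter)
  qed
  then show ?thesis
    by auto
qed

lemma deg_one_sum: "deg G u = deg G1 u + deg G2 u"
  by (simp add: deg_eq_card_nbrs nbrs_one_sum card_Un_disjoint G1.finite_nbrs G2.finite_nbrs
      nbrs_disjoint)

lemma laplacian_op_one_sum: "laplacian_op G f u = laplacian_op G1 f u + laplacian_op G2 f u"
  by (simp add: laplacian_op_def nbrs_one_sum sum.union_disjoint G1.finite_nbrs G2.finite_nbrs
      nbrs_disjoint)

lemma sum_deg_mult_left: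
  "(\<Sum>u\<in>pverts G. real (deg G1 u) * f u) = (\<Sum>u\<in>pverts G1. real (deg G1 u) * f u)"
  using pair_finite_verts verts_one_sum
  by (intro sum.mono_neutral_right) (auto simp: G1.deg_outside)

lemma num_edges_one_sum: "num_edges G = num_edges G1 + num_edges G2"
proof -
  have "2 * real (num_edges G) = 2 * real (num_edges G1) + 2 * real (num_edges G2)"
    using sum_deg_mult_left[of "\<lambda>_. 1"] one_sum.sum_deg_mult_left[OF one_sum_commute, of "\<lambda>_. 1"]
    by (simp add: deg_one_sum sum.distrib G1.sum_deg_eq_num_edges G2.sum_deg_eq_num_edges
        flip: sum_deg_eq_num_edges)
  then show ?thesis
    by linarith
qed

text \<open>Seen from \<open>G\<^sub>2\<close>, a target in \<open>G\<^sub>1\<close> is a target at \<open>v\<close>.\<close>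

lemma laplacian_op_right_exp_hit_time:
  assumes "j \<in> pverts G1" "u \<in> pverts G2"
  shows "laplacian_op G2 (\<lambda>x. exp_hit_time G x j) u
    = real (deg G2 u) - (if u = v then 2 * real (num_edges G2) else 0)"
proof (rule G2.laplacian_op_eq_deg_off_vertex[OF _ cut_vertex_in_verts(2) assms(2)])
  fix u assume "u \<in> pverts G2 - {v}"
  then have "u \<in> pverts G" "j \<in> pverts G" "u \<noteq> j" "u \<notin> pverts G1"
    using assms(1) verts_inter verts_one_sum by auto
  then show "laplacian_op G2 (\<lambda>x. exp_hit_time G x j) u = real (deg G2 u)"
    using laplacian_op_exp_hit_time[of u j]
    by (simp add: laplacian_op_one_sum deg_one_sum G1.laplacian_op_outside G1.deg_outside)
qed

lemma laplacian_op_left_exp_hit_time: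
  assumes "j \<in> pverts G1" "u \<in> pverts G1" "u \<noteq> j"
  shows "laplacian_op G1 (\<lambda>x. exp_hit_time G x j) u
    = real (deg G1 u) + (if u = v then 2 * real (num_edges G2) else 0)"
proof -
  have "laplacian_op G1 (\<lambda>x. exp_hit_time G x j) u + laplacian_op G2 (\<lambda>x. exp_hit_time G x j) u
      = real (deg G1 u) + real (deg G2 u)"
    using laplacian_op_exp_hit_time[of u j] assms verts_one_sum
    by (simp add: laplacian_op_one_sum deg_one_sum)
  moreover have "u \<in> pverts G2 \<longleftrightarrow> u = v"
    using assms(2) verts_inter by auto
  ultimately show ?thesis
    using laplacian_op_right_exp_hit_time[OF assms(1), of u]
    by (cases "u = v") (auto simp: G2.laplacian_op_outside G2.deg_outside)
qed

theorem exp_hit_time_from_cut_vertex: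
  assumes j: "j \<in> pverts G1"
  shows "exp_hit_time G v j = exp_hit_time G1 v j + 2 * real (num_edges G2) * eff_resistance G1 j v"
proof -
  define m1 where "m1 = real (num_edges G1)"
  define m2 where "m2 = real (num_edges G2)"
  have m1: "m1 > 0"
    using G1.num_edges_pos by (simp add: m1_def)
  define f where
    "f x = exp_hit_time G1 x j + m2 / m1 * (exp_hit_time G1 x j - exp_hit_time G1 x v)" for x
  have "laplacian_op G1 (\<lambda>x. exp_hit_time G x j) u = laplacian_op G1 f u"
    if "u \<in> pverts G1 - {j}" for u
    unfolding f_def laplacian_op_add laplacian_op_cmult laplacian_op_diff
    using that j m1 cut_vertex_in_verts
    by (simp add: laplacian_op_left_exp_hit_time G1.laplacian_op_exp_hit_time m1_def m2_def)
  then have "exp_hit_time G v j - exp_hit_time G j j = f v - f j"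
    using j cut_vertex_in_verts by (intro G1.diff_eq_if_laplacian_op_eq)
  also have "\<dots> = exp_hit_time G1 v j + m2 / m1 * (exp_hit_time G1 j v + exp_hit_time G1 v j)"
    by (simp add: f_def exp_hit_time_self algebra_simps)
  also have "\<dots> = exp_hit_time G1 v j + 2 * m2 * eff_resistance G1 j v"
    using G1.commute_time_identity[OF j cut_vertex_in_verts(1), symmetric] m1 by (simp flip: m1_def)
  finally show ?thesis
    by (simp add: exp_hit_time_self m2_def)
qed

lemma sum_deg_mult_exp_hit_time_left:
  "(\<Sum>j\<in>pverts G. real (deg G1 j) * exp_hit_time G v j)
    = 2 * real (num_edges G1) * kemeny G1 + 2 * real (num_edges G2) * moment G1 v"
proof -
  have "(\<Sum>j\<in>pverts G. real (deg G1 j) * exp_hit_time G v j)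
      = (\<Sum>j\<in>pverts G1. real (deg G1 j) * exp_hit_time G1 v j
          + 2 * real (num_edges G2) * (real (deg G1 j) * eff_resistance G1 j v))"
    unfolding sum_deg_mult_left
    by (intro sum.cong) (simp_all add: exp_hit_time_from_cut_vertex algebra_simps)
  also have "\<dots> = 2 * real (num_edges G1) * kemeny G1 + 2 * real (num_edges G2) * moment G1 v"
    by (simp add: G1.kemeny_eq[OF cut_vertex_in_verts(1)] moment_def sum.distrib sum_distrib_left)
  finally show ?thesis .
qed

theorem kemeny_one_sum:
  defines "m1 \<equiv> real (num_edges G1)" and "m2 \<equiv> real (num_edges G2)"
  shows "kemeny G
    = (m1 * kemeny G1 + m2 * kemeny G2 + m2 * moment G1 v + m1 * moment G2 v) / (m1 + m2)"
proof -
  have "2 * (m1 + m2) * kemeny G = (\<Sum>j\<in>pverts G. real (deg G j) * exp_hit_time G v j)"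
    using kemeny_eq[of v] cut_vertex_in_verts verts_one_sum
    by (simp add: num_edges_one_sum m1_def m2_def)
  also have "\<dots> = (\<Sum>j\<in>pverts G. real (deg G1 j) * exp_hit_time G v j)
      + (\<Sum>j\<in>pverts G. real (deg G2 j) * exp_hit_time G v j)"
    by (simp add: deg_one_sum distrib_right sum.distrib)
  also have "\<dots> = (2 * m1 * kemeny G1 + 2 * m2 * moment G1 v)
      + (2 * m2 * kemeny G2 + 2 * m1 * moment G2 v)"
    using sum_deg_mult_exp_hit_time_left one_sum.sum_deg_mult_exp_hit_time_left[OF one_sum_commute]
    by (simp add: m1_def m2_def)
  finally have "(m1 + m2) * kemeny G
      = m1 * kemeny G1 + m2 * kemeny G2 + m2 * moment G1 v + m1 * moment G2 v"
    by (simp add: algebra_simps)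
  moreover have "m1 + m2 > 0"
    using G1.num_edges_pos by (simp add: m1_def m2_def)
  ultimately show ?thesis
    by (simp add: field_simps)
qed

end

section \<open>Stars\<close>

locale nontrivial_star =
  fixes S :: "'a pair_pre_digraph" and c :: 'a
  assumes is_star: "is_star S c"
    and leaf_exists: "pverts S \<noteq> {c}"
begin

lemma finite_verts_star: "finite (pverts S)"
  and center_in_verts_star: "c \<in> pverts S"
  and arcs_star: "parcs S = {c} \<times> (pverts S - {c}) \<union> (pverts S - {c}) \<times> {c}"
  using is_star by (auto simp: is_star_def)

lemma pair_graph_star: "pair_graph S"
proof
  show "symmetric (with_proj S)"
    by (auto simp: symmetric_def arcs_star intro!: symI)
qed (use finite_verts_star center_in_verts_star in \<open>auto simp: arcs_star\<close>)

end

sublocale nontrivial_star \<subseteq> nontrivial_connected_graph S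
proof -
  interpret pair_graph S
    by (rule pair_graph_star)
  have "c \<rightarrow>\<^sup>*\<^bsub>S\<^esub> u" if "u \<in> pverts S" for u
    using that by (cases "u = c") (auto simp: arcs_star)
  then have "Digraph_Component.connected (with_proj S)"
    using center_in_verts_star by (rule connected_if_reachable_from[rotated])
  moreover have "parcs S \<noteq> {}"
    using leaf_exists center_in_verts_star by (auto simp: arcs_star)
  ultimately show "nontrivial_connected_graph S"
    by unfold_locales
qed

context nontrivial_star
begin

lemma nbrs_leaf: "p \<in> pverts S - {c} \<Longrightarrow> nbrs S p = {c}"
  and nbrs_center: "nbrs S c = pverts S - {c}"
  by (auto simp: nbrs_def arcs_star)

lemma deg_leaf: "p \<in> pverts S - {c} \<Longrightarrow> deg S p = 1"
  by (simp add: deg_eq_card_nbrs nbrs_leaf)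

lemma num_edges_star: "num_edges S = card (pverts S - {c})"
proof -
  have "2 * real (num_edges S) = real (deg S c) + (\<Sum>p\<in>pverts S - {c}. real (deg S p))"
    using sum.remove[OF finite_verts_star center_in_verts_star, of "\<lambda>u. real (deg S u)"]
    by (simp add: sum_deg_eq_num_edges)
  then show ?thesis
    by (simp add: deg_leaf deg_eq_card_nbrs[of S c] nbrs_center)
qed

lemma exp_hit_time_leaf_center:
  assumes "p \<in> pverts S - {c}"
  shows "exp_hit_time S p c = 1"
  using laplacian_op_exp_hit_time[of p c] assms center_in_verts_star
  by (simp add: laplacian_op_def nbrs_leaf deg_leaf exp_hit_time_self)

lemma exp_hit_time_center_leaf:
  assumes "p \<in> pverts S - {c}"
  shows "exp_hit_time S c p = 2 * real (num_edges S) - 1"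
  using laplacian_op_exp_hit_time[of p p] assms
  by (simp add: laplacian_op_def nbrs_leaf deg_leaf exp_hit_time_self)

lemma eff_resistance_leaf_center:
  assumes "p \<in> pverts S - {c}"
  shows "eff_resistance S p c = 1"
  using commute_time_identity[of p c] assms center_in_verts_star num_edges_pos
  by (simp add: exp_hit_time_leaf_center exp_hit_time_center_leaf)

lemma eff_resistance_center: "eff_resistance S c c = 0"
  using commute_time_identity[of c c] center_in_verts_star num_edges_pos
  by (simp add: exp_hit_time_self)

lemma moment_star: "moment S c = real (num_edges S)"
  using sum.remove[OF finite_verts_star center_in_verts_star,
      of "\<lambda>p. real (deg S p) * eff_resistance S p c"]
  by (simp add: moment_def eff_resistance_center eff_resistance_leaf_center deg_leaf num_edges_star)

lemma kemeny_star: "kemeny S = real (num_edges S) - 1 / 2"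
proof -
  have "2 * real (num_edges S) * kemeny S
      = (\<Sum>p\<in>pverts S - {c}. real (deg S p) * exp_hit_time S c p)"
    using kemeny_eq[OF center_in_verts_star]
      sum.remove[OF finite_verts_star center_in_verts_star,
        of "\<lambda>p. real (deg S p) * exp_hit_time S c p"]
    by (simp add: exp_hit_time_self)
  also have "\<dots> = 2 * real (num_edges S) * (real (num_edges S) - 1 / 2)"
    by (simp add: exp_hit_time_center_leaf deg_leaf num_edges_star algebra_simps)
  finally show ?thesis
    using num_edges_pos by simp
qed

end

theorem theorem4p5:
  fixes G G1 S :: "'a pair_pre_digraph" and v :: 'a and k m1 :: nat
  assumes "pair_graph G1"
    and "Digraph_Component.connected (with_proj G1)"
    and "m1 = num_edges G1"
    and "m1 \<ge> 1"
    and "v \<in> pverts G1"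
    and "k \<ge> 1"
    and "is_star S v"
    and "card (pverts S) = k + 1"
    and "is_one_sum G G1 v S"
  shows "kemeny G =
    (real m1 * kemeny G1 + real k * moment G1 v + real k * (real m1 + real k - 1 / 2))
      / (real m1 + real k)"
proof -
  interpret S: nontrivial_star S v
    using assms(6-8) by unfold_locales auto
  interpret G1: pair_graph G1
    by fact
  have "parcs G1 \<noteq> {}"
    using assms(3,4) by (auto simp: num_edges_def)
  then interpret one_sum G1 S G v
    using assms(2,9) by unfold_locales
  have "num_edges S = k"
    using assms(8) S.finite_verts_star S.center_in_verts_star by (simp add: S.num_edges_star)
  then show ?thesis
    using kemeny_one_sum assms(3) by (simp add: S.kemeny_star S.moment_star algebra_simps)
qed

end
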